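(* Let $k:\mathbb{R}^2\to\mathbb{R}^{n\times n}$ and $h:\mathbb{R}^n\to\mathbb{R}^n$ be continuously differentiable and set $K(t,s)=k(t,t+s)$. The map $g:\mathbb{R}\times C\to\mathbb{R}^n$ given by $$g(t,\phi)=J((S_h\circ P_o)(\phi),t)=\int_{-t}^0K(t,s)\,h((P_o\phi)(s))\,ds$$ is $C^1_F$-smooth.
   Context: Let $n\in\mathbb{N}$. $C=C((-\infty,0],\mathbb{R}^n)$ and $C_\infty=C(\mathbb{R},\mathbb{R}^n)$ are the Fréchet spaces of continuous maps with the topology of locally uniform convergence (seminorms $\max_{-j\le t\le0}|\phi(t)|$, respectively $\max_{-j\le t\le j}|\phi(t)|$, $j\in\mathbb{N}$). $P_o:C\to C_\infty$ is the odd prolongation map: $(P_o\phi)(s)=\phi(s)$ for $s\le0$ and $(P_o\phi)(s)=2\phi(0)-\phi(-s)$ for $s>0$. $S_h:C_\infty\to C_\infty$ is the substitution operator $S_h(\phi)=h\circ\phi$. $J:C_\infty\times\mathbb{R}\to\mathbb{R}^n$ is $J(\psi,t)=\int_{-t}^0K(t,s)\psi(s)\,ds$. Integrals $\int_{-t}^0$ for $t<0$ are oriented integrals. A continuous map $G:O\to W$, with $X,W$ topological vector spaces and $O\subset X$ open, is $C^1_F$-smooth if all directional derivatives $DG(u)v=\lim_{0\neq t\to0}\frac1t(G(u+tv)-G(u))$, $u\in O$, $v\in X$, exist, each $DG(u):X\to W$ is linear and continuous, and $O\ni u\mapsto DG(u)\in L_c(X,W)$ is continuous with respect to the topology of uniform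 convergence on bounded sets on the space $L_c(X,W)$ of continuous linear maps $X\to W$. Products carry the product topology. *)

theory Defs
  imports "HOL-Analysis.Analysis"
begin

text \<open>Topological vector spaces are Hausdorff by convention, so that directional derivatives
  are unique.\<close>

class topological_vector_space = real_vector + t2_space +
  assumes tendsto_add_nhds:
      "filterlim (\<lambda>p. fst p + snd p) (nhds (a + b)) (nhds a \<times>\<^sub>F nhds b)"
    and tendsto_scaleR_nhds:
      "filterlim (\<lambda>p. fst p *\<^sub>R snd p) (nhds (r *\<^sub>R b)) (nhds r \<times>\<^sub>F nhds b)"

lemma continuous_on_UNIV_iff_nhds:
  "continuous_on UNIV f \<longleftrightarrow> (\<forall>x. filterlim f (nhds (f x)) (nhds x))"
  unfolding continuous_on_def by (simp add: tendsto_at_iff_tendsto_nhds)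

lemma class_topological_vector_spaceI:
  assumes "continuous_on UNIV (\<lambda>p::'a \<times> 'a. fst p + snd p)"
    and "continuous_on UNIV (\<lambda>p::real \<times> 'a. fst p *\<^sub>R snd p)"
  shows "OFCLASS('a::{real_vector, t2_space}, topological_vector_space_class)"
proof
  show "filterlim (\<lambda>p. fst p + snd p) (nhds (a + b)) (nhds a \<times>\<^sub>F nhds b)" for a b :: 'a
    using assms(1)[unfolded continuous_on_UNIV_iff_nhds, rule_format, of "(a, b)"]
    by (simp add: nhds_prod)
  show "filterlim (\<lambda>p. fst p *\<^sub>R snd p) (nhds (r *\<^sub>R b)) (nhds r \<times>\<^sub>F nhds b)" for r and b :: 'a
    using assms(2)[unfolded continuous_on_UNIV_iff_nhds, rule_format, of "(r, b)"]
    by (simp add: nhds_prod)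
qed

lemma continuous_on_add_pair:
  "continuous_on UNIV (\<lambda>p::'a::topological_vector_space \<times> 'a. fst p + snd p)"
  using tendsto_add_nhds by (auto simp: continuous_on_UNIV_iff_nhds nhds_prod)

lemma continuous_on_scaleR_pair:
  "continuous_on UNIV (\<lambda>p::real \<times> 'a::topological_vector_space. fst p *\<^sub>R snd p)"
  using tendsto_scaleR_nhds by (auto simp: continuous_on_UNIV_iff_nhds nhds_prod)

instance real_normed_vector \<subseteq> topological_vector_space
  by (rule class_topological_vector_spaceI) (intro continuous_intros)+

lemma continuous_on_add_tvs:
  fixes f g :: "'a::topological_space \<Rightarrow> 'b::topological_vector_space"
  assumes "continuous_on S f" "continuous_on S g"
  shows "continuous_on S (\<lambda>x. f x + g x)"
  using continuous_on_compose2[OF continuous_on_add_pair continuous_on_Pair[OF assms]] by simp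

lemma continuous_on_scaleR_tvs:
  fixes f :: "'a::topological_space \<Rightarrow> real" and g :: "'a \<Rightarrow> 'b::topological_vector_space"
  assumes "continuous_on S f" "continuous_on S g"
  shows "continuous_on S (\<lambda>x. f x *\<^sub>R g x)"
  using continuous_on_compose2[OF continuous_on_scaleR_pair continuous_on_Pair[OF assms]] by simp

instance prod :: (topological_vector_space, topological_vector_space) topological_vector_space
proof (rule class_topological_vector_spaceI)
  show "continuous_on UNIV (\<lambda>p::('a \<times> 'b) \<times> ('a \<times> 'b). fst p + snd p)"
    unfolding plus_prod_def
    by (intro continuous_on_Pair continuous_on_add_tvs continuous_intros)
  show "continuous_on UNIV (\<lambda>p::real \<times> ('a \<times> 'b). fst p *\<^sub>R snd p)"
    unfolding scaleR_prod_def
    by (intro continuous_on_Pair continuous_on_scaleR_tvs continuous_intros)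
qed

definition tvs_bounded :: "'a::topological_vector_space set \<Rightarrow> bool" where
  "tvs_bounded B \<longleftrightarrow> (\<forall>N. open N \<and> 0 \<in> N \<longrightarrow> (\<exists>r>0. \<forall>t\<ge>r. B \<subseteq> (\<lambda>x. t *\<^sub>R x) ` N))"

lemma tvs_bounded_empty: "tvs_bounded {}"
  unfolding tvs_bounded_def by (auto intro: exI[of _ 1])

lemma tvs_bounded_Un:
  assumes "tvs_bounded A" "tvs_bounded B"
  shows "tvs_bounded (A \<union> B)"
  unfolding tvs_bounded_def
proof (intro allI impI)
  fix N :: "'a set" assume N: "open N \<and> 0 \<in> N"
  obtain r s where "r > 0" "\<forall>t\<ge>r. A \<subseteq> (\<lambda>x. t *\<^sub>R x) ` N"
    "s > 0" "\<forall>t\<ge>s. B \<subseteq> (\<lambda>x. t *\<^sub>R x) ` N"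
    using assms N unfolding tvs_bounded_def by meson
  then show "\<exists>r>0. \<forall>t\<ge>r. A \<union> B \<subseteq> (\<lambda>x. t *\<^sub>R x) ` N"
    by (intro exI[of _ "max r s"]) auto
qed

definition Lc :: "('a::topological_vector_space \<Rightarrow> 'b::topological_vector_space) set" where
  "Lc = {A. linear A \<and> continuous_on UNIV A}"

text \<open>The topology of uniform convergence on bounded sets: the sets
  \<open>{B \<in> Lc. \<forall>x\<in>M. B x - A x \<in> N}\<close>, for bounded \<open>M\<close> and neighbourhoods \<open>N\<close> of zero, form a
  neighbourhood base at \<open>A\<close>.\<close>

definition Lc_topology ::
    "('a::topological_vector_space \<Rightarrow> 'b::topological_vector_space) topology" where
  "Lc_topology = topology (\<lambda>U. U \<subseteq> Lc \<and>
     (\<forall>A\<in>U. \<exists>M N. tvs_bounded M \<and> open N \<and> 0 \<in> N \<and> {B \<in> Lc. \<forall>x\<in>M. B x - A x \<in> N} \<subseteq> U))"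

lemma openin_Lc_topology:
  "openin Lc_topology U \<longleftrightarrow> U \<subseteq> Lc \<and>
     (\<forall>A\<in>U. \<exists>M N. tvs_bounded M \<and> open N \<and> 0 \<in> N \<and> {B \<in> Lc. \<forall>x\<in>M. B x - A x \<in> N} \<subseteq> U)"
proof -
  let ?P = "\<lambda>U::('a \<Rightarrow> 'b) set. U \<subseteq> Lc \<and>
     (\<forall>A\<in>U. \<exists>M N. tvs_bounded M \<and> open N \<and> 0 \<in> N \<and> {B \<in> Lc. \<forall>x\<in>M. B x - A x \<in> N} \<subseteq> U)"
  have "istopology ?P"
    unfolding istopology_def
  proof (intro conjI allI impI)
    fix S T assume S: "?P S" and T: "?P T"
    show "S \<inter> T \<subseteq> Lc" using S by blast
    show "\<forall>A\<in>S \<inter> T. \<exists>M N. tvs_bounded M \<and> open N \<and> 0 \<in> N \<and>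
        {B \<in> Lc. \<forall>x\<in>M. B x - A x \<in> N} \<subseteq> S \<inter> T"
    proof
      fix A assume A: "A \<in> S \<inter> T"
      obtain M N where 1: "tvs_bounded M" "open N" "0 \<in> N" "{B \<in> Lc. \<forall>x\<in>M. B x - A x \<in> N} \<subseteq> S"
        using S A by (meson IntE)
      obtain M' N' where 2: "tvs_bounded M'" "open N'" "0 \<in> N'"
          "{B \<in> Lc. \<forall>x\<in>M'. B x - A x \<in> N'} \<subseteq> T"
        using T A by (meson IntE)
      have "{B \<in> Lc. \<forall>x\<in>M \<union> M'. B x - A x \<in> N \<inter> N'} \<subseteq> S \<inter> T"
        using 1(4) 2(4) by blast
      with 1 2 show "\<exists>M N. tvs_bounded M \<and> open N \<and> 0 \<in> N \<and>
          {B \<in> Lc. \<forall>x\<in>M. B x - A x \<in> N} \<subseteq> S \<inter> T"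
        by (intro exI[of _ "M \<union> M'"] exI[of _ "N \<inter> N'"]) (simp add: tvs_bounded_Un open_Int)
    qed
  next
    fix \<K> :: "('a \<Rightarrow> 'b) set set" assume K: "\<forall>K\<in>\<K>. ?P K"
    show "\<Union>\<K> \<subseteq> Lc" using K by blast
    show "\<forall>A\<in>\<Union>\<K>. \<exists>M N. tvs_bounded M \<and> open N \<and> 0 \<in> N \<and>
        {B \<in> Lc. \<forall>x\<in>M. B x - A x \<in> N} \<subseteq> \<Union>\<K>"
    proof
      fix A assume "A \<in> \<Union>\<K>"
      then obtain K where "K \<in> \<K>" "A \<in> K" by blast
      with K obtain M N where "tvs_bounded M \<and> open N \<and> 0 \<in> N \<and>
          {B \<in> Lc. \<forall>x\<in>M. B x - A x \<in> N} \<subseteq> K" by meson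
      with \<open>K \<in> \<K>\<close> show "\<exists>M N. tvs_bounded M \<and> open N \<and> 0 \<in> N \<and>
          {B \<in> Lc. \<forall>x\<in>M. B x - A x \<in> N} \<subseteq> \<Union>\<K>"
        by (intro exI[of _ M] exI[of _ N]) blast
    qed
  qed
  then show ?thesis
    unfolding Lc_topology_def by (simp add: topology_inverse')
qed

lemma topspace_Lc_topology: "topspace Lc_topology = Lc"
proof
  show "topspace Lc_topology \<subseteq> Lc"
    using openin_topspace openin_Lc_topology by blast
  have "openin Lc_topology (Lc :: ('a \<Rightarrow> 'b) set)"
    unfolding openin_Lc_topology
    by (intro conjI ballI exI[of _ "{}"] exI[of _ UNIV]) (auto simp: tvs_bounded_empty)
  then show "(Lc :: ('a \<Rightarrow> 'b) set) \<subseteq> topspace Lc_topology"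
    by (rule openin_subset)
qed

definition C1F_smooth ::
    "'a::topological_vector_space set \<Rightarrow> ('a \<Rightarrow> 'b::topological_vector_space) \<Rightarrow> bool" where
  "C1F_smooth S G \<longleftrightarrow> open S \<and> continuous_on S G \<and>
     (\<exists>DG :: 'a \<Rightarrow> 'a \<Rightarrow> 'b.
        (\<forall>u\<in>S. \<forall>v. ((\<lambda>t::real. (1 / t) *\<^sub>R (G (u + t *\<^sub>R v) - G u)) \<longlongrightarrow> DG u v) (at 0)) \<and>
        (\<forall>u\<in>S. linear (DG u) \<and> continuous_on UNIV (DG u)) \<and>
        continuous_map (top_of_set S) Lc_topology DG)"

definition continuously_differentiable ::
    "('a::real_normed_vector \<Rightarrow> 'b::real_normed_vector) \<Rightarrow> bool" where
  "continuously_differentiable f \<longleftrightarrow>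
     (\<exists>f' :: 'a \<Rightarrow> 'a \<Rightarrow>\<^sub>L 'b.
        (\<forall>x. (f has_derivative blinfun_apply (f' x)) (at x)) \<and> continuous_on UNIV f')"

text \<open>A continuous map on \<open>(-\<infinity>, 0]\<close> is represented by its extension with value zero on
  \<open>(0, \<infinity>)\<close>; the extension need not be continuous at zero.\<close>

typedef (overloaded) 'a cneg =
    "{f :: real \<Rightarrow> 'a::real_normed_vector. continuous_on {..0} f \<and> (\<forall>t>0. f t = 0)}"
  morphisms apply_cneg Abs_cneg
  by (intro exI[of _ "\<lambda>_. 0"]) simp

setup_lifting type_definition_cneg

lemma continuous_on_cneg: "continuous_on {..0} (apply_cneg \<phi>)"
  using apply_cneg by blast

lemma cneg_eq_0: "t > 0 \<Longrightarrow> apply_cneg \<phi> t = 0"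
  using apply_cneg by blast

lemma cneg_eqI: "(\<And>t. t \<le> 0 \<Longrightarrow> apply_cneg \<phi> t = apply_cneg \<psi> t) \<Longrightarrow> \<phi> = \<psi>"
  by (metis apply_cneg_inject cneg_eq_0 ext not_le)

instantiation cneg :: (real_normed_vector) real_vector
begin

lift_definition zero_cneg :: "'a cneg" is "\<lambda>_. 0" by simp
lift_definition plus_cneg :: "'a cneg \<Rightarrow> 'a cneg \<Rightarrow> 'a cneg" is "\<lambda>f g t. f t + g t"
  by (auto intro!: continuous_intros)
lift_definition uminus_cneg :: "'a cneg \<Rightarrow> 'a cneg" is "\<lambda>f t. - f t"
  by (auto intro!: continuous_intros)
lift_definition minus_cneg :: "'a cneg \<Rightarrow> 'a cneg \<Rightarrow> 'a cneg" is "\<lambda>f g t. f t - g t"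
  by (auto intro!: continuous_intros)
lift_definition scaleR_cneg :: "real \<Rightarrow> 'a cneg \<Rightarrow> 'a cneg" is "\<lambda>r f t. r *\<^sub>R f t"
  by (auto intro!: continuous_intros)

instance
  by standard (transfer; simp add: fun_eq_iff algebra_simps)+

end

lemmas cneg_apply_simps [simp] =
  zero_cneg.rep_eq plus_cneg.rep_eq uminus_cneg.rep_eq minus_cneg.rep_eq scaleR_cneg.rep_eq

definition cneg_seminorm :: "nat \<Rightarrow> 'a::real_normed_vector cneg \<Rightarrow> real" where
  "cneg_seminorm j \<phi> = (SUP t\<in>{- real j..0}. norm (apply_cneg \<phi> t))"

lemma cneg_seminorm_upper:
  assumes "- real j \<le> t" "t \<le> 0"
  shows "norm (apply_cneg \<phi> t) \<le> cneg_seminorm j \<phi>"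
proof -
  have "compact ((\<lambda>t. norm (apply_cneg \<phi> t)) ` {- real j..0})"
    by (intro compact_continuous_image continuous_on_norm
        continuous_on_subset[OF continuous_on_cneg]) auto
  then have "bdd_above ((\<lambda>t. norm (apply_cneg \<phi> t)) ` {- real j..0})"
    by (intro bounded_imp_bdd_above compact_imp_bounded)
  then show ?thesis
    unfolding cneg_seminorm_def using assms by (intro cSUP_upper) auto
qed

lemma cneg_seminorm_least:
  assumes "\<And>t. - real j \<le> t \<Longrightarrow> t \<le> 0 \<Longrightarrow> norm (apply_cneg \<phi> t) \<le> c"
  shows "cneg_seminorm j \<phi> \<le> c"
  unfolding cneg_seminorm_def using assms by (intro cSUP_least) auto

lemma cneg_seminorm_nonneg: "0 \<le> cneg_seminorm j \<phi>"
  by (rule order_trans[OF norm_ge_zero cneg_seminorm_upper[of j 0]]) simp_all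

lemma cneg_seminorm_mono: "i \<le> j \<Longrightarrow> cneg_seminorm i \<phi> \<le> cneg_seminorm j \<phi>"
  by (intro cneg_seminorm_least cneg_seminorm_upper) auto

lemma cneg_seminorm_triangle: "cneg_seminorm j (\<phi> + \<psi>) \<le> cneg_seminorm j \<phi> + cneg_seminorm j \<psi>"
  by (rule cneg_seminorm_least) (simp add: norm_triangle_mono cneg_seminorm_upper)

lemma cneg_seminorm_zero [simp]: "cneg_seminorm j 0 = 0"
  by (simp add: cneg_seminorm_def)

lemma cneg_seminorm_scaleR_le: "cneg_seminorm j (r *\<^sub>R \<phi>) \<le> \<bar>r\<bar> * cneg_seminorm j \<phi>"
  by (rule cneg_seminorm_least) (simp add: mult_left_mono cneg_seminorm_upper)

lemma cneg_seminorm_minus_commute: "cneg_seminorm j (\<phi> - \<psi>) = cneg_seminorm j (\<psi> - \<phi>)"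
  by (simp add: cneg_seminorm_def norm_minus_commute)

text \<open>The seminorms increase with \<open>j\<close>, so a single one suffices to describe a basic
  neighbourhood.\<close>

instantiation cneg :: (real_normed_vector) topological_space
begin

definition open_cneg :: "'a cneg set \<Rightarrow> bool" where
  "open_cneg U \<longleftrightarrow> (\<forall>\<phi>\<in>U. \<exists>j. \<exists>e>0. \<forall>\<psi>. cneg_seminorm j (\<psi> - \<phi>) < e \<longrightarrow> \<psi> \<in> U)"

instance
proof
  show "open (UNIV :: 'a cneg set)"
    unfolding open_cneg_def by (auto intro: exI[of _ 1])
next
  fix S T :: "'a cneg set" assume S: "open S" and T: "open T"
  show "open (S \<inter> T)"
    unfolding open_cneg_def
  proof
    fix \<phi> assume \<phi>: "\<phi> \<in> S \<inter> T"
    obtain i d where 1: "d > 0" "\<And>\<psi>. cneg_seminorm i (\<psi> - \<phi>) < d \<Longrightarrow> \<psi> \<in> S"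
      using S \<phi> unfolding open_cneg_def by (meson IntE)
    obtain j e where 2: "e > 0" "\<And>\<psi>. cneg_seminorm j (\<psi> - \<phi>) < e \<Longrightarrow> \<psi> \<in> T"
      using T \<phi> unfolding open_cneg_def by (meson IntE)
    have "\<psi> \<in> S \<inter> T" if "cneg_seminorm (max i j) (\<psi> - \<phi>) < min d e" for \<psi>
      using that 1(2)[of \<psi>] 2(2)[of \<psi>]
        cneg_seminorm_mono[of i "max i j" "\<psi> - \<phi>"] cneg_seminorm_mono[of j "max i j" "\<psi> - \<phi>"]
      by auto
    with 1(1) 2(1) show "\<exists>j. \<exists>e>0. \<forall>\<psi>. cneg_seminorm j (\<psi> - \<phi>) < e \<longrightarrow> \<psi> \<in> S \<inter> T"
      by (intro exI[of _ "max i j"] exI[of _ "min d e"]) auto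
  qed
next
  fix \<K> :: "'a cneg set set" assume K: "\<forall>S\<in>\<K>. open S"
  show "open (\<Union>\<K>)"
    unfolding open_cneg_def
  proof
    fix \<phi> assume "\<phi> \<in> \<Union>\<K>"
    then obtain S where S: "S \<in> \<K>" "\<phi> \<in> S" by blast
    with K obtain j e where "e > 0" "\<forall>\<psi>. cneg_seminorm j (\<psi> - \<phi>) < e \<longrightarrow> \<psi> \<in> S"
      unfolding open_cneg_def by meson
    with S show "\<exists>j. \<exists>e>0. \<forall>\<psi>. cneg_seminorm j (\<psi> - \<phi>) < e \<longrightarrow> \<psi> \<in> \<Union>\<K>"
      by blast
  qed
qed

end

lemma open_cneg_ball: "open {\<psi>. cneg_seminorm j (\<psi> - \<phi>) < e}"
  unfolding open_cneg_def
proof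
  fix \<psi> assume \<psi>: "\<psi> \<in> {\<psi>. cneg_seminorm j (\<psi> - \<phi>) < e}"
  have "cneg_seminorm j (\<xi> - \<phi>) < e"
    if "cneg_seminorm j (\<xi> - \<psi>) < e - cneg_seminorm j (\<psi> - \<phi>)" for \<xi>
    using that cneg_seminorm_triangle[of j "\<xi> - \<psi>" "\<psi> - \<phi>"] by simp
  with \<psi> show "\<exists>i. \<exists>d>0. \<forall>\<xi>. cneg_seminorm i (\<xi> - \<psi>) < d \<longrightarrow>
      \<xi> \<in> {\<psi>. cneg_seminorm j (\<psi> - \<phi>) < e}"
    by (intro exI[of _ j] exI[of _ "e - cneg_seminorm j (\<psi> - \<phi>)"]) auto
qed

instance cneg :: (real_normed_vector) t2_space
proof
  fix x y :: "'a cneg" assume "x \<noteq> y"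
  then obtain t where t: "t \<le> 0" "apply_cneg x t \<noteq> apply_cneg y t"
    using cneg_eqI by blast
  obtain j :: nat where "- t \<le> real j" using real_arch_simple by blast
  with t have d: "cneg_seminorm j (x - y) > 0"
    using cneg_seminorm_upper[of j t "x - y"] by (simp add: order_less_le_trans[rotated])
  let ?B = "\<lambda>z. {\<psi>. cneg_seminorm j (\<psi> - z) < cneg_seminorm j (x - y) / 2}"
  have "?B x \<inter> ?B y = {}"
  proof -
    have False if "\<psi> \<in> ?B x" "\<psi> \<in> ?B y" for \<psi>
      using that cneg_seminorm_triangle[of j "x - \<psi>" "\<psi> - y"]
        cneg_seminorm_minus_commute[of j x \<psi>] by simp
    then show ?thesis by blast
  qed
  moreover have "open (?B x)" "open (?B y)" by (rule open_cneg_ball)+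
  moreover have "x \<in> ?B x" "y \<in> ?B y" using d by simp_all
  ultimately show "\<exists>U V. open U \<and> open V \<and> x \<in> U \<and> y \<in> V \<and> U \<inter> V = {}"
    by blast
qed

instance cneg :: (real_normed_vector) topological_vector_space
proof (rule class_topological_vector_spaceI)
  show "continuous_on UNIV (\<lambda>p::'a cneg \<times> 'a cneg. fst p + snd p)"
    unfolding continuous_on_topological
  proof (intro ballI allI impI)
    fix p :: "'a cneg \<times> 'a cneg" and U assume "open U" "fst p + snd p \<in> U"
    then obtain j e where e: "e > 0"
        "\<And>\<psi>. cneg_seminorm j (\<psi> - (fst p + snd p)) < e \<Longrightarrow> \<psi> \<in> U"
      unfolding open_cneg_def by meson
    let ?A = "{\<psi>. cneg_seminorm j (\<psi> - fst p) < e / 2} \<times> {\<psi>. cneg_seminorm j (\<psi> - snd p) < e / 2}"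
    have "fst q + snd q \<in> U" if "q \<in> ?A" for q
    proof (rule e(2))
      have eq: "fst q + snd q - (fst p + snd p) = (fst q - fst p) + (snd q - snd p)" by simp
      show "cneg_seminorm j (fst q + snd q - (fst p + snd p)) < e"
        unfolding eq using that cneg_seminorm_triangle[of j "fst q - fst p" "snd q - snd p"]
        by (auto simp: mem_Times_iff)
    qed
    moreover have "open ?A" "p \<in> ?A"
      by (intro open_Times open_cneg_ball) (simp add: mem_Times_iff e(1))
    ultimately show "\<exists>A. open A \<and> p \<in> A \<and> (\<forall>q\<in>UNIV. q \<in> A \<longrightarrow> fst q + snd q \<in> U)"
      by blast
  qed
  show "continuous_on UNIV (\<lambda>p::real \<times> 'a cneg. fst p *\<^sub>R snd p)"
    unfolding continuous_on_topological
  proof (intro ballI allI impI)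
    fix p :: "real \<times> 'a cneg" and U assume "open U" "fst p *\<^sub>R snd p \<in> U"
    then obtain j e where e: "e > 0"
        "\<And>\<psi>. cneg_seminorm j (\<psi> - fst p *\<^sub>R snd p) < e \<Longrightarrow> \<psi> \<in> U"
      unfolding open_cneg_def by meson
    obtain r \<phi> where p: "p = (r, \<phi>)" by (cases p)
    define c where "c = cneg_seminorm j \<phi>"
    define \<delta> where "\<delta> = min 1 (e / (2 * (c + 1)))"
    define d where "d = e / (2 * (\<bar>r\<bar> + 1))"
    have c: "c \<ge> 0" unfolding c_def by (rule cneg_seminorm_nonneg)
    have \<delta>: "\<delta> > 0" "\<delta> \<le> 1" using e(1) c by (auto simp: \<delta>_def)
    have \<delta>c: "\<delta> * c \<le> e / 2"
    proof -
      have "\<delta> * c \<le> e / (2 * (c + 1)) * (c + 1)"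
        using c e(1) by (intro mult_mono) (auto simp: \<delta>_def)
      also have "\<dots> = e / 2" using c by (simp add: field_simps)
      finally show ?thesis .
    qed
    have d: "d > 0" "(\<bar>r\<bar> + 1) * d = e / 2"
      using e(1) by (auto simp: d_def divide_simps add_pos_nonneg)
    let ?A = "ball r \<delta> \<times> {\<psi>. cneg_seminorm j (\<psi> - \<phi>) < d}"
    have "s *\<^sub>R \<psi> \<in> U" if s: "\<bar>s - r\<bar> < \<delta>" and \<psi>: "cneg_seminorm j (\<psi> - \<phi>) < d" for s \<psi>
    proof (rule e(2))
      have eq: "s *\<^sub>R \<psi> - r *\<^sub>R \<phi> = s *\<^sub>R (\<psi> - \<phi>) + (s - r) *\<^sub>R \<phi>"
        by (simp add: algebra_simps)
      have "cneg_seminorm j (s *\<^sub>R \<psi> - r *\<^sub>R \<phi>)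
          \<le> \<bar>s\<bar> * cneg_seminorm j (\<psi> - \<phi>) + \<bar>s - r\<bar> * c"
        unfolding eq c_def
        by (rule order_trans[OF cneg_seminorm_triangle add_mono])
          (rule cneg_seminorm_scaleR_le)+
      also have "\<bar>s\<bar> * cneg_seminorm j (\<psi> - \<phi>) \<le> (\<bar>r\<bar> + 1) * cneg_seminorm j (\<psi> - \<phi>)"
        using s \<delta>(2) by (intro mult_right_mono cneg_seminorm_nonneg) auto
      also have "\<dots> < (\<bar>r\<bar> + 1) * d"
        using \<psi> by (intro mult_strict_left_mono) auto
      also have "\<bar>s - r\<bar> * c \<le> \<delta> * c"
        using s c by (intro mult_right_mono) auto
      finally show "cneg_seminorm j (s *\<^sub>R \<psi> - fst p *\<^sub>R snd p) < e"
        using d(2) \<delta>c by (simp add: p)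
    qed
    then have "\<forall>q\<in>?A. fst q *\<^sub>R snd q \<in> U"
      by (auto simp: dist_real_def abs_minus_commute)
    moreover have "open ?A" "p \<in> ?A"
      by (intro open_Times open_cneg_ball open_ball) (simp add: p \<delta>(1) d(1))
    ultimately show "\<exists>A. open A \<and> p \<in> A \<and> (\<forall>q\<in>UNIV. q \<in> A \<longrightarrow> fst q *\<^sub>R snd q \<in> U)"
      by blast
  qed
qed

typedef (overloaded) 'a cinf = "{f :: real \<Rightarrow> 'a::real_normed_vector. continuous_on UNIV f}"
  morphisms apply_cinf Abs_cinf
  by (intro exI[of _ "\<lambda>_. 0"]) simp

setup_lifting type_definition_cinf

lift_definition odd_prolongation :: "'a::real_normed_vector cneg \<Rightarrow> 'a cinf" is
  "\<lambda>\<phi> s. if s \<le> 0 then \<phi> s else 2 *\<^sub>R \<phi> 0 - \<phi> (- s)"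
proof -
  fix \<phi> :: "real \<Rightarrow> 'a" assume "continuous_on {..0} \<phi> \<and> (\<forall>t>0. \<phi> t = 0)"
  then have c: "continuous_on {..0} \<phi>" by blast
  have "continuous_on {0..} (\<lambda>s. \<phi> (- s))"
    by (rule continuous_on_compose2[OF c]) (auto intro!: continuous_intros)
  then have "continuous_on ({..0} \<union> {0..}) (\<lambda>s. if s \<le> 0 then \<phi> s else 2 *\<^sub>R \<phi> 0 - \<phi> (- s))"
    using c
    by (intro continuous_on_cases) (auto intro!: continuous_intros simp: scaleR_2)
  moreover have "{..0} \<union> {0..} = (UNIV :: real set)" by auto
  ultimately show "continuous_on UNIV (\<lambda>s. if s \<le> 0 then \<phi> s else 2 *\<^sub>R \<phi> 0 - \<phi> (- s))" by simp
qed

text \<open>The value is unspecified unless \<open>h \<circ> \<phi>\<close> is continuous, in particular it is as intended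
  for continuous \<open>h\<close>.\<close>

definition substitution_op ::
    "('a::real_normed_vector \<Rightarrow> 'a) \<Rightarrow> 'a cinf \<Rightarrow> 'a cinf" where
  "substitution_op h \<phi> = Abs_cinf (h \<circ> apply_cinf \<phi>)"

lemma apply_substitution_op:
  assumes "continuous_on UNIV h"
  shows "apply_cinf (substitution_op h \<phi>) = h \<circ> apply_cinf \<phi>"
proof -
  have "continuous_on UNIV (apply_cinf \<phi>)" using apply_cinf by blast
  then have "continuous_on UNIV (h \<circ> apply_cinf \<phi>)"
    using assms by (intro continuous_on_compose continuous_on_subset[OF assms]) auto
  then show ?thesis
    unfolding substitution_op_def by (simp add: Abs_cinf_inverse)
qed

text \<open>For \<open>t < 0\<close> the interval integral is oriented, i.e. minus the integral over \<open>(0, -t)\<close>.\<close>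

definition J_op ::
    "(real \<Rightarrow> real \<Rightarrow> real^'n^'n) \<Rightarrow> (real^'n) cinf \<times> real \<Rightarrow> real^'n" where
  "J_op K = (\<lambda>(\<psi>, t). LBINT s=ereal (- t)..0. K t s *v apply_cinf \<psi> s)"

end

theory Submission
  imports Defs
begin

text \<open>The endpoint \<open>- t\<close> and the integrand are treated separately: differentiating in \<open>t\<close> produces the
  integrand at \<open>- t\<close>, which needs only continuity of \<open>\<phi>\<close>, while \<open>(t, x) \<mapsto> K t s *v h x\<close> is \<open>C\<^sup>1\<close> with
  derivative jointly continuous in \<open>s\<close>. The derivative at \<open>(t, \<phi>)\<close> in direction \<open>(\<tau>, \<xi>)\<close> is
  \<open>\<tau>\<close> times this boundary value plus the integral of an operator-valued kernel \<open>B(t, \<phi>)(s)\<close> applied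
  to \<open>(\<tau>, (P\<^sub>o \<xi>)(s))\<close>. Since \<open>\<phi>\<close> enters the kernel through evaluation, which is jointly continuous,
  the \<open>L\<^sup>1\<close>-distance of two kernels on a compact interval is continuous in \<open>(t, \<phi>)\<close>; it bounds the
  difference of the derivatives uniformly for \<open>(\<tau>, \<xi>)\<close> in a bounded set.\<close>

section \<open>Oriented integrals over the past\<close>

text \<open>The oriented integral of \<open>f\<close> from \<open>- t\<close> to \<open>0\<close>, rescaled to the unit interval so that
  dependence on the limit of integration becomes dependence of the integrand.\<close>

definition past_integral :: "(real \<Rightarrow> 'a::banach) \<Rightarrow> real \<Rightarrow> 'a" where
  "past_integral f t = t *\<^sub>R integral {0..1} (\<lambda>r. f (- (t * r)))"

lemma past_integral_0 [simp]: "past_integral f 0 = 0"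
  by (simp add: past_integral_def)

text \<open>By the chain rule \<open>- t\<close> times the rescaled integrand is the derivative of
  \<open>F (- (t * r))\<close> in \<open>r\<close>, so the fundamental theorem on [0, 1] covers both
  signs of \<open>t\<close> at once.\<close>

lemma past_integral_antiderivative:
  assumes F: "\<And>s. (F has_vector_derivative f s) (at s)"
  shows "past_integral f t = F 0 - F (- t)"
proof -
  have "((\<lambda>r. F (- (t * r))) has_vector_derivative (- t) *\<^sub>R f (- (t * r))) (at r within {0..1})" for r
  proof -
    have "((\<lambda>r. - (t * r)) has_vector_derivative - t) (at r within {0..1})"
      unfolding has_real_derivative_iff_has_vector_derivative[symmetric]
      by (auto intro!: derivative_eq_intros)
    from vector_diff_chain_within[OF this has_vector_derivative_at_within[OF F]]
    show ?thesis by (simp add: o_def)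
  qed
  then have "((\<lambda>r. (- t) *\<^sub>R f (- (t * r))) has_integral F (- (t * 1)) - F (- (t * 0))) {0..1}"
    by (intro fundamental_theorem_of_calculus) auto
  from integral_unique[OF this]
  have "(- t) *\<^sub>R integral {0..1} (\<lambda>r. f (- (t * r))) = F (- t) - F 0"
    unfolding integral_cmul by simp
  then show ?thesis
    by (simp add: past_integral_def algebra_simps)
qed

text \<open>The fundamental theorem is local to a compact interval; the one from
  \<open>- \<bar>s\<bar> - 1\<close> to \<open>\<bar>s\<bar> + 1\<close> contains the base point 0
  and has \<open>s\<close> in its interior.\<close>

lemma has_antiderivative_real:
  fixes f :: "real \<Rightarrow> 'a::euclidean_space"
  assumes f: "continuous_on UNIV f"
  obtains F where "\<And>s. (F has_vector_derivative f s) (at s)"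
proof
  fix s :: real
  have "((\<lambda>u. LBINT y=0..u. f y) has_vector_derivative f s) (at s within {- \<bar>s\<bar> - 1..\<bar>s\<bar> + 1})"
    using interval_integral_FTC2[of "- \<bar>s\<bar> - 1" 0 "\<bar>s\<bar> + 1" f s] continuous_on_subset[OF f]
    by (auto simp: zero_ereal_def)
  moreover have "at s within {- \<bar>s\<bar> - 1..\<bar>s\<bar> + 1} = at s"
    by (rule at_within_interior) (simp add: abs_if)
  ultimately show "((\<lambda>u. LBINT y=0..u. f y) has_vector_derivative f s) (at s)"
    by simp
qed

text \<open>Both integrals are the same difference of values of an antiderivative. This links the
  oriented Lebesgue integral to the rescaled one.\<close>

lemma LBINT_eq_past_integral:
  fixes f :: "real \<Rightarrow> 'a::euclidean_space"
  assumes f: "continuous_on UNIV f"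
  shows "(LBINT s=ereal (- t)..0. f s) = past_integral f t"
proof -
  obtain F where F: "\<And>s. (F has_vector_derivative f s) (at s)"
    using has_antiderivative_real[OF f] by blast
  have "(LBINT s=ereal (- t)..ereal 0. f s) = F 0 - F (- t)"
    by (intro interval_integral_FTC_finite continuous_on_subset[OF f]
        has_vector_derivative_at_within[OF F]) auto
  then show ?thesis
    using past_integral_antiderivative[of F f, OF F] by (simp add: zero_ereal_def)
qed

lemma past_integral_has_vector_derivative:
  fixes f :: "real \<Rightarrow> 'a::euclidean_space"
  assumes f: "continuous_on UNIV f"
  shows "(past_integral f has_vector_derivative f (- t)) (at t)"
proof -
  obtain F where F: "\<And>s. (F has_vector_derivative f s) (at s)"
    using has_antiderivative_real[OF f] by blast
  have "(uminus has_vector_derivative - 1) (at t)"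
    unfolding has_real_derivative_iff_has_vector_derivative[symmetric]
    by (auto intro!: derivative_eq_intros)
  from has_vector_derivative_diff[OF has_vector_derivative_const vector_diff_chain_at[OF this F]]
  have "((\<lambda>t. F 0 - F (- t)) has_vector_derivative f (- t)) (at t)"
    by (simp add: o_def)
  moreover have "past_integral f = (\<lambda>t. F 0 - F (- t))"
    using past_integral_antiderivative[of F f, OF F] by blast
  ultimately show ?thesis by simp
qed

text \<open>The gain of the rescaling: the interval of integration is the fixed compact [0, 1], so
  joint continuity of the integrand suffices even when the endpoint moves.\<close>

lemma continuous_on_past_integral:
  fixes f :: "'a::topological_space \<Rightarrow> real \<Rightarrow> 'b::banach"
  assumes f: "continuous_on UNIV (\<lambda>(x, s). f x s)" and a: "continuous_on UNIV a"
  shows "continuous_on UNIV (\<lambda>x. past_integral (f x) (a x))"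
proof -
  have "continuous_on (UNIV \<times> cbox 0 1) (\<lambda>(x, r). f x (- (a x * r)))"
    using continuous_on_compose2[OF f, of "UNIV \<times> cbox 0 1" "\<lambda>p. (fst p, - (a (fst p) * snd p))"]
    by (simp add: case_prod_unfold continuous_intros continuous_on_compose2[OF a])
  then have "continuous_on UNIV (\<lambda>x. integral (cbox 0 1) (\<lambda>r. f x (- (a x * r))))"
    by (rule integral_continuous_on_param)
  then show ?thesis
    unfolding past_integral_def by (intro continuous_intros a) simp
qed

lemma past_integrable:
  fixes f :: "real \<Rightarrow> 'a::banach"
  assumes "continuous_on UNIV f"
  shows "(\<lambda>r. f (- (t * r))) integrable_on {0..1}"
  by (intro integrable_continuous_real continuous_on_compose2[OF assms] continuous_intros) auto

lemma past_integral_add: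
  assumes "continuous_on UNIV f" "continuous_on UNIV g"
  shows "past_integral (\<lambda>s. f s + g s) t = past_integral f t + past_integral g t"
  using assms by (simp add: past_integral_def integral_add past_integrable scaleR_add_right)

lemma past_integral_diff:
  assumes "continuous_on UNIV f" "continuous_on UNIV g"
  shows "past_integral (\<lambda>s. f s - g s) t = past_integral f t - past_integral g t"
  using assms by (simp add: past_integral_def integral_diff past_integrable scaleR_diff_right)

lemma past_integral_scaleR:
  "past_integral (\<lambda>s. c *\<^sub>R f s) t = c *\<^sub>R past_integral f t"
  by (simp add: past_integral_def)

text \<open>A mean value inequality in the endpoint; the absolute value on the right absorbs the
  orientation. The bound is asked for on a compact interval only, because a single seminorm controls
  no more than that.\<close>

lemma norm_past_integral_diff_le:
  fixes f :: "real \<Rightarrow> 'a::euclidean_space" and g :: "real \<Rightarrow> real"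
  assumes f: "continuous_on UNIV f" and g: "continuous_on UNIV g"
    and le: "\<And>s. \<bar>s\<bar> \<le> max \<bar>t\<bar> \<bar>u\<bar> \<Longrightarrow> norm (f s) \<le> g s"
  shows "norm (past_integral f t - past_integral f u) \<le> \<bar>past_integral g t - past_integral g u\<bar>"
proof -
  have *: "norm (past_integral f b - past_integral f a) \<le> past_integral g b - past_integral g a"
    if "a < b" "\<And>s. - b \<le> s \<Longrightarrow> s \<le> - a \<Longrightarrow> norm (f s) \<le> g s" for a b
  \<comment> \<open>The derivative at \<open>x\<close> is the integrand at \<open>- x\<close>, hence
    the reflected interval in the hypothesis.\<close>
  proof (rule differentiable_bound_general[OF that(1)])
    show "continuous_on {a..b} (past_integral f)" "continuous_on {a..b} (past_integral g)"
      using past_integral_has_vector_derivative[OF f] past_integral_has_vector_derivative[OF g]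
      by (auto intro!: continuous_at_imp_continuous_on dest: has_vector_derivative_continuous)
    show "(past_integral f has_vector_derivative f (- x)) (at x)"
      "(past_integral g has_vector_derivative g (- x)) (at x)" for x
      by (intro past_integral_has_vector_derivative f g)+
    show "norm (f (- x)) \<le> g (- x)" if "a < x" "x < b" for x
      using that \<open>\<And>s. - b \<le> s \<Longrightarrow> s \<le> - a \<Longrightarrow> norm (f s) \<le> g s\<close> by simp
  qed
  consider "t = u" | "t < u" | "u < t" by linarith
  then show ?thesis
  proof cases
    case 2
    then have "norm (past_integral f u - past_integral f t) \<le> past_integral g u - past_integral g t"
      by (intro * le) auto
    then show ?thesis by (simp add: norm_minus_commute)
  next
    case 3
    then have "norm (past_integral f t - past_integral f u) \<le> past_integral g t - past_integral g u"
      by (intro * le) auto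
    then show ?thesis by simp
  qed simp
qed

lemma has_vector_derivative_imp_tendsto_quotient:
  assumes "(f has_vector_derivative f') (at 0)"
  shows "((\<lambda>e. (1 / e) *\<^sub>R (f e - f 0)) \<longlongrightarrow> f') (at 0)"
proof (rule LIM_zero_cancel, rule tendsto_norm_zero_cancel)
  have "((\<lambda>e. norm (f e - f 0 - e *\<^sub>R f') / norm e) \<longlongrightarrow> 0) (at 0)"
    using assms unfolding has_vector_derivative_def has_derivative_iff_norm by simp
  moreover have "norm (f e - f 0 - e *\<^sub>R f') / norm e = norm ((1 / e) *\<^sub>R (f e - f 0) - f')"
    if "e \<noteq> 0" for e
  proof -
    have "(1 / e) *\<^sub>R (f e - f 0) - f' = (1 / e) *\<^sub>R (f e - f 0 - e *\<^sub>R f')"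
      using that by (simp add: scaleR_diff_right)
    then show ?thesis by simp
  qed
  then have "\<forall>\<^sub>F e in at 0. norm (f e - f 0 - e *\<^sub>R f') / norm e =
      norm ((1 / e) *\<^sub>R (f e - f 0) - f')"
    by (simp add: eventually_at_filter)
  ultimately show "((\<lambda>e. norm ((1 / e) *\<^sub>R (f e - f 0) - f')) \<longlongrightarrow> 0) (at 0)"
    by (rule Lim_transform_eventually)
qed

section \<open>The odd prolongation\<close>

abbreviation oddp :: "'a::real_normed_vector cneg \<Rightarrow> real \<Rightarrow> 'a" where
  "oddp \<phi> \<equiv> apply_cinf (odd_prolongation \<phi>)"

lemma oddp_add: "oddp (\<phi> + \<psi>) s = oddp \<phi> s + oddp \<psi> s"
  by (simp add: odd_prolongation.rep_eq algebra_simps)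

lemma oddp_diff: "oddp (\<phi> - \<psi>) s = oddp \<phi> s - oddp \<psi> s"
  by (simp add: odd_prolongation.rep_eq algebra_simps)

lemma oddp_scaleR: "oddp (c *\<^sub>R \<phi>) s = c *\<^sub>R oddp \<phi> s"
  by (simp add: odd_prolongation.rep_eq algebra_simps)

lemma continuous_on_oddp: "continuous_on UNIV (oddp \<phi>)"
  using apply_cinf by blast

text \<open>The factor 3 is 2 + 1, from \<open>2 *\<^sub>R \<phi> 0\<close> and the reflected value,
  both taken within the range of the seminorm.\<close>

lemma norm_oddp_le:
  assumes "\<bar>s\<bar> \<le> real j"
  shows "norm (oddp \<phi> s) \<le> 3 * cneg_seminorm j \<phi>"
proof (cases "s \<le> 0")
  case True
  then show ?thesis
    using assms cneg_seminorm_upper[of j s \<phi>] cneg_seminorm_nonneg[of j \<phi>]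
    by (simp add: odd_prolongation.rep_eq)
next
  case False
  then show ?thesis
    using assms cneg_seminorm_upper[of j "- s" \<phi>] cneg_seminorm_upper[of j 0 \<phi>]
      norm_triangle_ineq4[of "2 *\<^sub>R apply_cneg \<phi> 0" "apply_cneg \<phi> (- s)"]
    by (simp add: odd_prolongation.rep_eq)
qed

text \<open>A change of the function costs at most three times a seminorm, uniformly near
  \<open>s\<close>; a change of the point is covered by continuity of one fixed
  prolongation.\<close>

lemma continuous_on_oddp_pair: "continuous_on UNIV (\<lambda>p. oddp (fst p) (snd p))"
  unfolding continuous_on_def
proof (intro ballI tendstoI)
  fix p :: "'a cneg \<times> real" and e :: real assume e: "e > 0"
  obtain \<phi> s where p: "p = (\<phi>, s)" by fastforce
  \<comment> \<open>The margin 1 keeps every point at distance less than 1 from \<open>s\<close>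
    within reach of the seminorm \<open>j\<close>.\<close>
  obtain j :: nat where j: "\<bar>s\<bar> + 1 \<le> real j" using real_arch_simple by blast
  obtain d where d: "d > 0" "\<And>u. dist u s < d \<Longrightarrow> dist (oddp \<phi> u) (oddp \<phi> s) < e / 2"
    using continuous_on_oddp[of \<phi>] e unfolding continuous_on_iff
    by (metis UNIV_I half_gt_zero)
  let ?A = "{\<psi>. cneg_seminorm j (\<psi> - \<phi>) < e / 6} \<times> ball s (min 1 d)"
  have "open ?A" "p \<in> ?A"
    by (intro open_Times open_cneg_ball open_ball) (use e d(1) in \<open>simp_all add: p\<close>)
  moreover have "dist (oddp \<psi> u) (oddp \<phi> s) < e" if "(\<psi>, u) \<in> ?A" for \<psi> u
  proof -
    have "\<bar>u\<bar> \<le> real j" using that j by (auto simp: dist_real_def)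
    then have "norm (oddp \<psi> u - oddp \<phi> u) \<le> 3 * cneg_seminorm j (\<psi> - \<phi>)"
      by (metis norm_oddp_le oddp_diff)
    also have "\<dots> < e / 2" using that by simp
    finally have "dist (oddp \<psi> u) (oddp \<phi> u) < e / 2" by (simp add: dist_norm)
    moreover have "dist (oddp \<phi> u) (oddp \<phi> s) < e / 2"
      using that by (intro d(2)) (auto simp: dist_commute)
    ultimately show ?thesis
      using dist_triangle[of "oddp \<psi> u" "oddp \<phi> s" "oddp \<phi> u"] by linarith
  qed
  ultimately show "\<forall>\<^sub>F q in at p within UNIV. dist (oddp (fst q) (snd q)) (oddp (fst p) (snd p)) < e"
    unfolding eventually_at_topological
    by (intro exI[of _ ?A]) (auto simp: p)
qed

lemma continuous_on_oddp_comp [continuous_intros]: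
  assumes "continuous_on S f" "continuous_on S g"
  shows "continuous_on S (\<lambda>x. oddp (f x) (g x))"
  using continuous_on_compose2[OF continuous_on_oddp_pair continuous_on_Pair[OF assms]] by simp

text \<open>The product of the two open unit balls is a neighbourhood of zero, so some multiple of
  it absorbs \<open>M\<close>; the scaling factor serves as \<open>c\<close> and may depend on
  \<open>j\<close>.\<close>

lemma tvs_bounded_real_cneg:
  assumes "tvs_bounded (M :: (real \<times> 'a::real_normed_vector cneg) set)"
  obtains c where "c > 0" "\<And>\<tau> \<xi>. (\<tau>, \<xi>) \<in> M \<Longrightarrow> \<bar>\<tau>\<bar> \<le> c \<and> cneg_seminorm j \<xi> \<le> c"
proof -
  let ?N = "ball (0::real) 1 \<times> {\<psi>::'a cneg. cneg_seminorm j (\<psi> - 0) < 1}"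
  have "open ?N" by (intro open_Times open_cneg_ball open_ball)
  moreover have "0 \<in> ?N" by (simp add: zero_prod_def)
  ultimately have "\<exists>r>0. \<forall>t\<ge>r. M \<subseteq> (\<lambda>x. t *\<^sub>R x) ` ?N"
    using assms[unfolded tvs_bounded_def, rule_format, of ?N] by simp
  then obtain r where r: "r > 0" "M \<subseteq> (\<lambda>x. r *\<^sub>R x) ` ?N"
    by (meson order_refl)
  show ?thesis
  proof (rule that[OF r(1)])
    fix \<tau> \<xi> assume "(\<tau>, \<xi>) \<in> M"
    from subsetD[OF r(2) this]
    obtain \<sigma> \<psi> where s: "\<tau> = r * \<sigma>" "\<xi> = r *\<^sub>R \<psi>" "\<bar>\<sigma>\<bar> < 1" "cneg_seminorm j \<psi> < 1"
      using r(1) by auto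
    have "cneg_seminorm j \<xi> \<le> r * cneg_seminorm j \<psi>"
      using cneg_seminorm_scaleR_le[of j r \<psi>] r(1) s(2) by simp
    also have "\<dots> \<le> r" using s(4) r(1) by simp
    finally show "\<bar>\<tau>\<bar> \<le> r \<and> cneg_seminorm j \<xi> \<le> r"
      using s(1,3) r(1) by (simp add: abs_mult)
  qed
qed


section \<open>Superposition under an integral over the past\<close>

text \<open>The variable of differentiation is the pair \<open>(t, x)\<close>, while
  \<open>s\<close> is a parameter; \<open>x\<close> will be the value of the prolongation at
  \<open>s\<close>.\<close>

locale past_superposition =
  fixes F :: "real \<times> 'a::real_normed_vector \<Rightarrow> real \<Rightarrow> 'b::euclidean_space"
    and F' :: "real \<times> 'a \<Rightarrow> real \<Rightarrow> (real \<times> 'a) \<Rightarrow>\<^sub>L 'b"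
  assumes F_deriv: "((\<lambda>p. F p s) has_derivative blinfun_apply (F' p s)) (at p)"
    and F_cont: "continuous_on UNIV (\<lambda>(p, s). F p s)"
    and F'_cont: "continuous_on UNIV (\<lambda>(p, s). F' p s)"
begin

lemma continuous_on_F [continuous_intros]:
  assumes "continuous_on S p" "continuous_on S q"
  shows "continuous_on S (\<lambda>x. F (p x) (q x))"
  using continuous_on_compose2[OF F_cont continuous_on_Pair[OF assms]] by simp

lemma continuous_on_F' [continuous_intros]:
  assumes "continuous_on S p" "continuous_on S q"
  shows "continuous_on S (\<lambda>x. F' (p x) (q x))"
  using continuous_on_compose2[OF F'_cont continuous_on_Pair[OF assms]] by simp

section \<open>The functional, its candidate derivative and their continuity\<close>

definition functional :: "real \<times> 'a cneg \<Rightarrow> 'b" where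
  "functional u = past_integral (\<lambda>s. F (fst u, oddp (snd u) s) s) (fst u)"

definition boundary :: "real \<times> 'a cneg \<Rightarrow> 'b" where
  "boundary u = F (fst u, oddp (snd u) (- fst u)) (- fst u)"

definition kernel :: "real \<times> 'a cneg \<Rightarrow> real \<Rightarrow> (real \<times> 'a) \<Rightarrow>\<^sub>L 'b" where
  "kernel u s = F' (fst u, oddp (snd u) s) s"

text \<open>The Leibniz rule. Since the prolongation is linear, the direction \<open>snd v\<close>
  enters through its own prolongation.\<close>

definition functional_deriv :: "real \<times> 'a cneg \<Rightarrow> real \<times> 'a cneg \<Rightarrow> 'b" where
  "functional_deriv u v = fst v *\<^sub>R boundary u +
     past_integral (\<lambda>s. kernel u s (fst v, oddp (snd v) s)) (fst u)"

lemma continuous_on_kernel [continuous_intros]: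
  assumes "continuous_on S p" "continuous_on S q"
  shows "continuous_on S (\<lambda>x. kernel (p x) (q x))"
  unfolding kernel_def by (intro continuous_intros assms)

lemma continuous_on_boundary: "continuous_on UNIV boundary"
  unfolding boundary_def[abs_def] by (intro continuous_intros)

lemma continuous_on_functional: "continuous_on UNIV functional"
  unfolding functional_def[abs_def]
  by (intro continuous_on_past_integral) (auto simp: case_prod_unfold intro!: continuous_intros)

lemma linear_functional_deriv: "linear (functional_deriv u)"
proof (rule linearI)
  fix v w :: "real \<times> 'a cneg" and c :: real
  show "functional_deriv u (v + w) = functional_deriv u v + functional_deriv u w"
  proof -
    have "kernel u s (fst (v + w), oddp (snd (v + w)) s) =
        kernel u s (fst v, oddp (snd v) s) + kernel u s (fst w, oddp (snd w) s)" for s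
      by (simp add: oddp_add flip: blinfun.add_right)
    moreover have "continuous_on UNIV (\<lambda>s. kernel u s (fst v, oddp (snd v) s))" for v
      by (intro continuous_intros)
    ultimately show ?thesis
      unfolding functional_deriv_def by (simp add: past_integral_add algebra_simps)
  qed
  show "functional_deriv u (c *\<^sub>R v) = c *\<^sub>R functional_deriv u v"
  proof -
    have "kernel u s (fst (c *\<^sub>R v), oddp (snd (c *\<^sub>R v)) s) =
        c *\<^sub>R kernel u s (fst v, oddp (snd v) s)" for s
      by (simp add: oddp_scaleR flip: blinfun.scaleR_right)
    then show ?thesis
      unfolding functional_deriv_def by (simp add: past_integral_scaleR algebra_simps)
  qed
qed

lemma continuous_on_functional_deriv: "continuous_on UNIV (functional_deriv u)"
  unfolding functional_deriv_def[abs_def]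
  by (intro continuous_on_past_integral continuous_on_add continuous_intros)
    (auto simp: case_prod_unfold intro!: continuous_intros)

lemma functional_deriv_Lc: "functional_deriv u \<in> Lc"
  by (simp add: Lc_def linear_functional_deriv continuous_on_functional_deriv)

text \<open>The increment is split into the change of the integrand, to which Hadamard's lemma gives a
  difference quotient continuous up to \<open>e = 0\<close>, and the change of the endpoint.\<close>

lemma functional_directional_derivative:
  "((\<lambda>e. (1 / e) *\<^sub>R (functional (u + e *\<^sub>R v) - functional u)) \<longlongrightarrow> functional_deriv u v) (at 0)"
proof -
  obtain t \<phi> \<tau> \<xi> where uv: "u = (t, \<phi>)" "v = (\<tau>, \<xi>)" by fastforce
  define f where "f e s = F (t + e * \<tau>, oddp (\<phi> + e *\<^sub>R \<xi>) s) s" for e s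
  define f' where "f' e s = F' (t + e * \<tau>, oddp (\<phi> + e *\<^sub>R \<xi>) s) s (\<tau>, oddp \<xi> s)" for e s
  \<comment> \<open>The mean of \<open>f'\<close> over the segment from 0 to \<open>e\<close>: the
    difference quotient of \<open>f\<close> for nonzero \<open>e\<close>, and \<open>f' 0\<close> at
    \<open>e = 0\<close>.\<close>
  define q where "q e s = integral {0..1} (\<lambda>r. f' (e * r) s)" for e s
  have curve: "continuous_on UNIV (\<lambda>p::real \<times> real. oddp (\<phi> + fst p *\<^sub>R \<xi>) (snd p))"
    unfolding oddp_add oddp_scaleR by (intro continuous_intros)
  have f'_cont: "continuous_on UNIV (\<lambda>p. f' (fst p) (snd p))"
    unfolding f'_def by (intro continuous_intros curve)
  have f_cont: "continuous_on UNIV (\<lambda>p. f (fst p) (snd p))"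
    unfolding f_def by (intro continuous_intros curve)
  have f_deriv: "((\<lambda>e. f e s) has_vector_derivative f' e s) (at e within S)" for e s S
  proof -
    have "((\<lambda>e. (t + e * \<tau>, oddp \<phi> s + e *\<^sub>R oddp \<xi> s)) has_derivative
        (\<lambda>d. d *\<^sub>R (\<tau>, oddp \<xi> s))) (at e within S)"
      by (auto intro!: derivative_eq_intros)
    from has_derivative_compose[OF this F_deriv]
    show ?thesis
      unfolding has_vector_derivative_def f_def f'_def oddp_add oddp_scaleR
      \<comment> \<open>The pair must stay a single scaled vector for homogeneity of the derivative
        to apply.\<close>
      by (simp add: blinfun.scaleR_right del: scaleR_Pair)
  qed
  have increment: "f e s - f 0 s = e *\<^sub>R q e s" for e s
  proof -
    have "((\<lambda>r. f (e * r) s) has_vector_derivative e *\<^sub>R f' (e * r) s) (at r within {0..1})" for r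
    proof -
      have "((\<lambda>r. e * r) has_vector_derivative e) (at r within {0..1})"
        unfolding has_real_derivative_iff_has_vector_derivative[symmetric]
        by (auto intro!: derivative_eq_intros)
      from vector_diff_chain_within[OF this f_deriv]
      show ?thesis by (simp add: o_def)
    qed
    then have "((\<lambda>r. e *\<^sub>R f' (e * r) s) has_integral f (e * 1) s - f (e * 0) s) {0..1}"
      by (intro fundamental_theorem_of_calculus) auto
    from integral_unique[OF this] show ?thesis
      unfolding integral_cmul by (simp add: q_def)
  qed
  have "continuous_on (UNIV \<times> cbox 0 1) (\<lambda>(p, r). f' (fst p * r) (snd p))"
    using continuous_on_compose2[OF f'_cont, of _ "\<lambda>p. (fst (fst p) * snd p, snd (fst p))"]
    by (simp add: case_prod_unfold continuous_intros)
  from integral_continuous_on_param[OF this]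
  have q_cont: "continuous_on UNIV (\<lambda>(e, s). q e s)"
    by (simp add: q_def case_prod_unfold)
  \<comment> \<open>Quotient and endpoint vary together, and joint continuity treats both at
    once.\<close>
  have "continuous_on UNIV (\<lambda>e. past_integral (q e) (t + e * \<tau>))"
    by (intro continuous_on_past_integral q_cont continuous_intros)
  then have "isCont (\<lambda>e. past_integral (q e) (t + e * \<tau>)) 0"
    by (simp add: continuous_on_eq_continuous_at)
  moreover have "q 0 = f' 0" by (simp add: q_def fun_eq_iff)
  ultimately have lim1: "((\<lambda>e. past_integral (q e) (t + e * \<tau>)) \<longlongrightarrow> past_integral (f' 0) t) (at 0)"
    by (simp add: isCont_def)
  have f_cont1: "continuous_on UNIV (f e)" for e
    using continuous_on_compose2[OF f_cont, of UNIV "\<lambda>s. (e, s)"]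
    by (simp add: continuous_intros)
  have q_cont1: "continuous_on UNIV (q e)" for e
    using continuous_on_compose2[OF q_cont, of UNIV "\<lambda>s. (e, s)"]
    by (simp add: continuous_intros)
  \<comment> \<open>Now the integrand is frozen at \<open>e = 0\<close> and only the endpoint moves,
    which yields the boundary term.\<close>
  have "((\<lambda>e. t + e * \<tau>) has_vector_derivative \<tau>) (at 0)"
    unfolding has_real_derivative_iff_has_vector_derivative[symmetric]
    by (auto intro!: derivative_eq_intros)
  from vector_diff_chain_at[OF this past_integral_has_vector_derivative[OF f_cont1]]
  have "((\<lambda>e. past_integral (f 0) (t + e * \<tau>)) has_vector_derivative \<tau> *\<^sub>R f 0 (- t)) (at 0)"
    by (simp add: o_def)
  then have lim2: "((\<lambda>e. (1 / e) *\<^sub>R (past_integral (f 0) (t + e * \<tau>) - past_integral (f 0) t))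
      \<longlongrightarrow> \<tau> *\<^sub>R f 0 (- t)) (at 0)"
    using has_vector_derivative_imp_tendsto_quotient by fastforce
  have "(1 / e) *\<^sub>R (functional (u + e *\<^sub>R v) - functional u) =
      (1 / e) *\<^sub>R (past_integral (f 0) (t + e * \<tau>) - past_integral (f 0) t) +
      past_integral (q e) (t + e * \<tau>)" if "e \<noteq> 0" for e
  proof -
    have "functional (u + e *\<^sub>R v) = past_integral (\<lambda>s. f 0 s + e *\<^sub>R q e s) (t + e * \<tau>)"
      by (simp add: functional_def uv f_def[symmetric] flip: increment)
    also have "\<dots> = past_integral (f 0) (t + e * \<tau>) + e *\<^sub>R past_integral (q e) (t + e * \<tau>)"
      by (simp add: past_integral_add past_integral_scaleR f_cont1 q_cont1 continuous_intros)
    finally have "functional (u + e *\<^sub>R v) - functional u =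
        (past_integral (f 0) (t + e * \<tau>) - past_integral (f 0) t) +
        e *\<^sub>R past_integral (q e) (t + e * \<tau>)"
      by (simp add: functional_def uv f_def[abs_def])
    then show ?thesis using that by (simp add: scaleR_add_right)
  qed
  then have "\<forall>\<^sub>F e in at 0. (1 / e) *\<^sub>R (past_integral (f 0) (t + e * \<tau>) - past_integral (f 0) t) +
      past_integral (q e) (t + e * \<tau>) = (1 / e) *\<^sub>R (functional (u + e *\<^sub>R v) - functional u)"
    by (simp add: eventually_at_filter)
  moreover have "functional_deriv u v = \<tau> *\<^sub>R f 0 (- t) + past_integral (f' 0) t"
    by (simp add: functional_deriv_def boundary_def kernel_def uv f_def f'_def[abs_def])
  ultimately show ?thesis
    using Lim_transform_eventually[OF tendsto_add[OF lim2 lim1]] by simp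
qed

section \<open>Continuity of the derivative for uniform convergence on bounded sets\<close>

text \<open>Controls \<open>functional_deriv w - functional_deriv u\<close> uniformly on bounded sets.\<close>

definition deriv_gap :: "real \<times> 'a cneg \<Rightarrow> real \<times> 'a cneg \<Rightarrow> real" where
  "deriv_gap u w = norm (boundary w - boundary u) +
     \<bar>past_integral (\<lambda>s. norm (kernel w s - kernel u s)) (fst w)\<bar> +
     \<bar>past_integral (\<lambda>s. norm (kernel u s)) (fst w) -
       past_integral (\<lambda>s. norm (kernel u s)) (fst u)\<bar>"

lemma continuous_on_deriv_gap: "continuous_on UNIV (deriv_gap u)"
  unfolding deriv_gap_def[abs_def]
  by (intro continuous_intros continuous_on_past_integral continuous_on_boundary)
    (auto simp: case_prod_unfold intro!: continuous_intros)

text \<open>Three changes are estimated separately: the boundary value, the kernel up to the new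
  endpoint, and the endpoint with the old kernel. The factor 4 is 1 + 3, from
  \<open>\<bar>fst v\<bar>\<close> and the prolongation of \<open>snd v\<close>.\<close>

lemma functional_deriv_diff_le:
  assumes "\<bar>fst u\<bar> \<le> real j" "\<bar>fst w\<bar> \<le> real j" "\<bar>fst v\<bar> \<le> c" "cneg_seminorm j (snd v) \<le> c"
  shows "norm (functional_deriv w v - functional_deriv u v) \<le> 4 * c * deriv_gap u w"
proof -
  let ?y = "\<lambda>s. (fst v, oddp (snd v) s)"
  have c: "c \<ge> 0" using assms(3) by linarith
  have y: "norm (?y s) \<le> 4 * c" if "\<bar>s\<bar> \<le> real j" for s
    using norm_Pair_le[of "fst v" "oddp (snd v) s"] norm_oddp_le[OF that, of "snd v"] assms by simp
  have bound: "norm (A (?y s)) \<le> (4 * c) *\<^sub>R norm A"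
    if "\<bar>s\<bar> \<le> real j" for s and A :: "(real \<times> 'a) \<Rightarrow>\<^sub>L 'b"
    using order_trans[OF norm_blinfun mult_left_mono[OF y[OF that] norm_ge_zero], of A]
    by (simp add: mult.commute)
  have cont: "continuous_on UNIV (\<lambda>s. kernel x s (?y s))" for x
    by (intro continuous_intros)
  have 1: "norm (past_integral (\<lambda>s. (kernel w s - kernel u s) (?y s)) (fst w)) \<le>
      4 * c * \<bar>past_integral (\<lambda>s. norm (kernel w s - kernel u s)) (fst w)\<bar>"
  proof -
    \<comment> \<open>The past integral up to 0 vanishes; subtracting it gives the form with two
      endpoints.\<close>
    have "norm (past_integral (\<lambda>s. (kernel w s - kernel u s) (?y s)) (fst w) -
          past_integral (\<lambda>s. (kernel w s - kernel u s) (?y s)) 0) \<le>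
        \<bar>past_integral (\<lambda>s. (4 * c) *\<^sub>R norm (kernel w s - kernel u s)) (fst w) -
          past_integral (\<lambda>s. (4 * c) *\<^sub>R norm (kernel w s - kernel u s)) 0\<bar>"
      by (intro norm_past_integral_diff_le continuous_intros bound) (use assms in auto)
    then show ?thesis
      using c unfolding past_integral_scaleR by (simp add: abs_mult)
  qed
  have 2: "norm (past_integral (\<lambda>s. kernel u s (?y s)) (fst w) -
        past_integral (\<lambda>s. kernel u s (?y s)) (fst u)) \<le>
      4 * c * \<bar>past_integral (\<lambda>s. norm (kernel u s)) (fst w) -
       past_integral (\<lambda>s. norm (kernel u s)) (fst u)\<bar>"
  proof -
    have "norm (past_integral (\<lambda>s. kernel u s (?y s)) (fst w) -
          past_integral (\<lambda>s. kernel u s (?y s)) (fst u)) \<le>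
        \<bar>past_integral (\<lambda>s. (4 * c) *\<^sub>R norm (kernel u s)) (fst w) -
          past_integral (\<lambda>s. (4 * c) *\<^sub>R norm (kernel u s)) (fst u)\<bar>"
      by (intro norm_past_integral_diff_le continuous_intros bound) (use assms in auto)
    also have "\<dots> = \<bar>(4 * c) * (past_integral (\<lambda>s. norm (kernel u s)) (fst w) -
        past_integral (\<lambda>s. norm (kernel u s)) (fst u))\<bar>"
      unfolding past_integral_scaleR by (simp add: right_diff_distrib)
    finally show ?thesis
      using c by (simp add: abs_mult)
  qed
  have 3: "norm (fst v *\<^sub>R (boundary w - boundary u)) \<le> 4 * c * norm (boundary w - boundary u)"
    using assms(3) c by (simp add: mult_right_mono)
  \<comment> \<open>The integral with kernel \<open>kernel u\<close> and endpoint
    \<open>fst w\<close> is subtracted and added.\<close>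
  have eq: "functional_deriv w v - functional_deriv u v = fst v *\<^sub>R (boundary w - boundary u) +
      past_integral (\<lambda>s. (kernel w s - kernel u s) (?y s)) (fst w) +
      (past_integral (\<lambda>s. kernel u s (?y s)) (fst w) -
        past_integral (\<lambda>s. kernel u s (?y s)) (fst u))"
    by (simp add: functional_deriv_def blinfun.diff_left past_integral_diff[OF cont cont]
        algebra_simps)
  show ?thesis
    unfolding eq deriv_gap_def distrib_left
    by (intro norm_triangle_mono 1 2 3)
qed

lemma continuous_map_functional_deriv:
  "continuous_map (top_of_set UNIV) Lc_topology functional_deriv"
  unfolding continuous_map_def
proof (intro conjI allI impI)
  show "functional_deriv \<in> topspace (top_of_set UNIV) \<rightarrow> topspace Lc_topology"
    by (simp add: topspace_Lc_topology functional_deriv_Lc)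
  fix U :: "(real \<times> 'a cneg \<Rightarrow> 'b) set" assume U: "openin Lc_topology U"
  have "\<exists>T. open T \<and> u \<in> T \<and> T \<subseteq> {w. functional_deriv w \<in> U}"
    if u: "functional_deriv u \<in> U" for u
  proof -
    obtain M N where M: "tvs_bounded M" and N: "open N" "0 \<in> N"
      and MN: "{B \<in> Lc. \<forall>x\<in>M. B x - functional_deriv u x \<in> N} \<subseteq> U"
      using U u unfolding openin_Lc_topology by meson
    obtain e where e: "e > 0" "ball 0 e \<subseteq> N"
      using N open_contains_ball by blast
    \<comment> \<open>Strictness makes the same \<open>j\<close> work for all endpoints near
      \<open>fst u\<close>. It is fixed before \<open>c\<close>, which depends on it.\<close>
    obtain j :: nat where j: "\<bar>fst u\<bar> < real j" using reals_Archimedean2 by blast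
    obtain c where c: "c > 0"
      "\<And>\<tau> \<xi>. (\<tau>, \<xi>) \<in> M \<Longrightarrow> \<bar>\<tau>\<bar> \<le> c \<and> cneg_seminorm j \<xi> \<le> c"
      using tvs_bounded_real_cneg[OF M] by blast
    let ?T = "{w. \<bar>fst w\<bar> < real j} \<inter> {w. deriv_gap u w < e / (4 * c)}"
    have "open ?T"
      by (intro open_Int open_Collect_less continuous_intros continuous_on_deriv_gap)
    \<comment> \<open>The gap vanishes at \<open>w = u\<close>, so its continuity makes
      \<open>?T\<close> a neighbourhood of \<open>u\<close>.\<close>
    moreover have "u \<in> ?T"
      using j e(1) c(1) by (simp add: deriv_gap_def past_integral_def)
    moreover have "functional_deriv w \<in> U" if w: "w \<in> ?T" for w
    proof -
      have "functional_deriv w v - functional_deriv u v \<in> N" if v: "v \<in> M" for v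
      proof -
        have "norm (functional_deriv w v - functional_deriv u v) \<le> 4 * c * deriv_gap u w"
          using w v j c(2)[of "fst v" "snd v"] by (intro functional_deriv_diff_le[where j = j]) auto
        also have "\<dots> < e"
          using w c(1) by (simp add: field_simps)
        finally show ?thesis
          using e(2) by auto
      qed
      with MN functional_deriv_Lc show ?thesis by blast
    qed
    ultimately show ?thesis by blast
  qed
  then have "open {w. functional_deriv w \<in> U}"
    by (subst open_subopen) blast
  then show "openin (top_of_set UNIV) {u \<in> topspace (top_of_set UNIV). functional_deriv u \<in> U}"
    by simp
qed

theorem C1F_smooth_functional: "C1F_smooth UNIV functional"
  unfolding C1F_smooth_def
  using continuous_on_functional functional_directional_derivative linear_functional_deriv
    continuous_on_functional_deriv continuous_map_functional_deriv
  by (intro conjI exI[of _ functional_deriv]) auto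

end

section \<open>The integral operator with differentiable kernel\<close>

lemma bounded_bilinear_matrix_vector_mult:
  "bounded_bilinear ((*v) :: real^'n^'m \<Rightarrow> real^'n \<Rightarrow> real^'m)"
  unfolding bilinear_conv_bounded_bilinear[symmetric] bilinear_def
  by (auto intro!: linearI simp: algebra_simps scaleR_matrix_vector_assoc matrix_vector_mult_scaleR)

text \<open>The product rule in \<open>(t, x)\<close>. As \<open>t\<close> occurs in both arguments
  of \<open>k\<close>, its derivative is applied to \<open>(fst d, fst d)\<close>.\<close>

lemma past_superposition_kernel:
  fixes k :: "real \<times> real \<Rightarrow> real^'n^'n" and h :: "real^'n \<Rightarrow> real^'n"
  assumes "continuously_differentiable k" "continuously_differentiable h"
  obtains F' where "past_superposition (\<lambda>p s. k (fst p, fst p + s) *v h (snd p)) F'"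
proof -
  interpret mv: bounded_bilinear "(*v) :: real^'n^'n \<Rightarrow> real^'n \<Rightarrow> real^'n"
    by (rule bounded_bilinear_matrix_vector_mult)
  obtain k' where k': "\<And>x. (k has_derivative blinfun_apply (k' x)) (at x)" "continuous_on UNIV k'"
    using assms(1) unfolding continuously_differentiable_def by blast
  obtain h' where h': "\<And>x. (h has_derivative blinfun_apply (h' x)) (at x)" "continuous_on UNIV h'"
    using assms(2) unfolding continuously_differentiable_def by blast
  have k: "continuous_on UNIV k" and h: "continuous_on UNIV h"
    using k'(1) h'(1)
    by (auto intro!: continuous_at_imp_continuous_on dest: has_derivative_continuous)
  note comp = continuous_on_compose2[OF k _ subset_UNIV] continuous_on_compose2[OF h _ subset_UNIV]
    continuous_on_compose2[OF k'(2) _ subset_UNIV] continuous_on_compose2[OF h'(2) _ subset_UNIV]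
  define D where "D p s d = k (fst p, fst p + s) *v h' (snd p) (snd d) +
      k' (fst p, fst p + s) (fst d, fst d) *v h (snd p)" for p s d
  have D: "((\<lambda>p. k (fst p, fst p + s) *v h (snd p)) has_derivative D p s) (at p)" for p s
  proof -
    have "((\<lambda>p. k (fst p, fst p + s)) has_derivative (\<lambda>d. k' (fst p, fst p + s) (fst d, fst d))) (at p)"
      by (rule has_derivative_compose[OF _ k'(1)]) (auto intro!: derivative_eq_intros)
    moreover have "((\<lambda>p::real \<times> (real^'n). h (snd p)) has_derivative (\<lambda>d. h' (snd p) (snd d))) (at p)"
      by (rule has_derivative_compose[OF _ h'(1)]) (auto intro!: derivative_eq_intros)
    ultimately show ?thesis
      unfolding D_def[abs_def] by (rule mv.FDERIV)
  qed
  define F' where "F' p s = Blinfun (D p s)" for p s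
  have F': "blinfun_apply (F' p s) = D p s" for p s
    unfolding F'_def by (rule bounded_linear_Blinfun_apply) (rule has_derivative_bounded_linear[OF D])
  have "past_superposition (\<lambda>p s. k (fst p, fst p + s) *v h (snd p)) F'"
  proof
    show "((\<lambda>p. k (fst p, fst p + s) *v h (snd p)) has_derivative F' p s) (at p)" for p s
      unfolding F' by (rule D)
    show "continuous_on UNIV (\<lambda>(p, s). k (fst p, fst p + s) *v h (snd p))"
      unfolding case_prod_unfold by (intro mv.continuous_on comp continuous_intros)
    show "continuous_on UNIV (\<lambda>(p, s). F' p s)"
      \<comment> \<open>The domain is finite-dimensional, so continuity in operator norm may be
        checked on basis vectors.\<close>
      by (rule continuous_on_blinfun_componentwise, unfold case_prod_unfold F' D_def)
        (intro mv.continuous_on comp continuous_intros)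
  qed
  then show ?thesis by (rule that)
qed

theorem corollary7p3:
  fixes k :: "real \<times> real \<Rightarrow> real^'n^'n"
    and h :: "real^'n \<Rightarrow> real^'n"
    and K :: "real \<Rightarrow> real \<Rightarrow> real^'n^'n"
    and g :: "real \<times> (real^'n) cneg \<Rightarrow> real^'n"
  assumes "continuously_differentiable k"
    and "continuously_differentiable h"
    and "\<And>t s. K t s = k (t, t + s)"
    and "\<And>t \<phi>. g (t, \<phi>) = J_op K (substitution_op h (odd_prolongation \<phi>), t)"
  shows "(\<forall>t \<phi>. g (t, \<phi>) =
            (LBINT s=ereal (- t)..0. K t s *v h (apply_cinf (odd_prolongation \<phi>) s))) \<and>
         C1F_smooth UNIV g"
proof -
  obtain F' where "past_superposition (\<lambda>p s. k (fst p, fst p + s) *v h (snd p)) F'"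
    using past_superposition_kernel[OF assms(1,2)] .
  then interpret past_superposition "\<lambda>p s. k (fst p, fst p + s) *v h (snd p)" F' .
  \<comment> \<open>Continuity of \<open>h\<close> guarantees that \<open>substitution_op h\<close>
    is composition with \<open>h\<close> and not an unspecified value.\<close>
  have "continuous_on UNIV h"
    using assms(2) unfolding continuously_differentiable_def
    by (auto intro!: continuous_at_imp_continuous_on dest: has_derivative_continuous)
  then have g: "g (t, \<phi>) = (LBINT s=ereal (- t)..0. K t s *v h (oddp \<phi> s))" for t \<phi>
    by (simp add: assms(4) J_op_def apply_substitution_op)
  have "g (t, \<phi>) = functional (t, \<phi>)" for t \<phi>
  proof -
    have "continuous_on UNIV (\<lambda>s. k (t, t + s) *v h (oddp \<phi> s))"
      using continuous_on_F[of UNIV "\<lambda>s. (t, oddp \<phi> s)" "\<lambda>s. s"]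
      by (simp add: continuous_intros continuous_on_oddp)
    then show ?thesis
      by (simp add: g assms(3) functional_def LBINT_eq_past_integral)
  qed
  then have "g = functional" by auto
  then show ?thesis
    using g C1F_smooth_functional by simp
qed

end
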